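(* Let $\mathcal{P}(X,U)$ be a system of linear DPPEs with implicit ideal $\mathrm{ID}$ and let $\phi$ be a linear perturbation with $\partial\mathrm{CRes}(F_1^\phi,\dots,F_n^\phi)\ne0$. Let $D_\phi$ be the lowest degree of $p$ in $\partial\mathrm{CRes}(F_1^\phi,\dots,F_n^\phi)$ and let $A_{D_\phi}$ be the coefficient of $p^{D_\phi}$ in it. Then the linear differential polynomial $A_{D_\phi}$ belongs to $(\mathrm{PS})\cap\mathbb{K}\{X\}$.
   Context: Setting. $\mathbb{K}$ is an ordinary differential field with derivation $\partial$, $n\ge 2$, $X=\{x_1,\dots,x_n\}$ and $U=\{u_1,\dots,u_{n-1}\}$ are sets of differential indeterminates over $\mathbb{K}$, $x_{ik}=\partial^kx_i$, $u_{jk}=\partial^ku_j$. $\mathrm{ord}(P,y)$ is the order of $P$ in $y$, equal to $-1$ if $P$ has no term in $y$ or its derivatives. "Linear" means of degree at most $1$. A system $\mathcal{P}(X,U)$ of linear DPPEs is $x_i=P_i(U)$, $i=1,\dots,n$, with $P_i\in\mathbb{K}\{U\}$ of degree at most $1$, not all in $\mathbb{K}$. Write $F_i=x_i-P_i(U)=x_i-a_i+H_i(U)$ with $a_i\in\mathbb{K}$ and $H_i\in\mathbb{K}\{U\}$ homogeneous linear. For each $j$ there is an $i$ with $\mathrm{ord}(F_i,u_j)\ge0$. The implicit ideal is $\mathrm{ID}=\{f\in\mathbb{K}\{X\}\mid f(P_1(U),\dots,P_n(U))=0\}$. Let $o_i$ be the order of $F_i$ in the variables $U$ (order $0$ if no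 $u_j$ occurs), $N=\sum_io_i$, $\gamma_j=\min_i\{o_i-\mathrm{ord}(F_i,u_j)\}$, $\gamma=\sum_{j=1}^{n-1}\gamma_j$. Standing assumption: $\gamma\le N-o_i$ for all $i$. Let $\mathrm{PS}=\{\partial^kF_i\mid 1\le i\le n,\ 0\le k\le N-o_i-\gamma\}$, a set of $L=\sum_i(N-o_i-\gamma+1)$ polynomials in $\mathbb{K}[\mathcal{X}][\mathcal{V}]$, where $\mathcal{X}=\{x_{ik}\mid 1\le i\le n,\ 0\le k\le N-o_i-\gamma\}$ and $\mathcal{V}=\{u_{jk}\mid 1\le j\le n-1,\ 0\le k\le N-\gamma_j-\gamma\}$ has $L-1$ elements. $(\mathrm{PS})$ is the ideal generated by $\mathrm{PS}$ in $\mathbb{K}[\mathcal{X}][\mathcal{V}]$. Perturbation. $p$ is a differential indeterminate over $\mathbb{K}$ with $\partial(p)=0$, $\mathbb{K}_p=\mathbb{K}\langle p\rangle$. A linear perturbation is a family $\phi=(\phi_1(U),\dots,\phi_n(U))$ of linear differential polynomials in $\mathbb{K}\{U\}$; the perturbed system is $x_i=P_i(U)+p\,\phi_i(U)$ and $F_i^\phi=F_i-p\,\phi_i(U)$. It is assumed that the integers $o_i$, $\gamma_j$ computed for $F_1^\phi,\dots,F_n^\phi$ are the same as for $F_1,\dots,F_n$, so that $\mathrm{PS}_\phi=\{\partial^kF_i^\phi\mid 0\le k\le N-o_i-\gamma\}\subset\mathbb{K}_p[\mathcal{X}][\mathcal{V}]$. The differential resultant $\partial\mathrm{CRes}(F_1^\phi,\dots,F_n^\phi)$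 is the determinant of the $L\times L$ matrix whose rows list, for $i=1,\dots,n$ successively, the coefficients of $\partial^{N-o_i-\gamma}F_i^\phi,\dots,\partial F_i^\phi,F_i^\phi$ in the variables of $\mathcal{V}$ in decreasing order for the orderly ranking on $U$ with $u_1<\dots<u_{n-1}$ (derivatives of higher order are larger; equal orders are compared by index), the last column containing the terms free of $U$. It is a polynomial in $p$ whose coefficients are linear differential polynomials in $\mathbb{K}\{X\}$. *)

theory Defs
  imports
    "HOL-Library.Poly_Mapping"
    "HOL-Computational_Algebra.Polynomial_Factorial"
    "HOL-Algebra.Ideal"
    "Jordan_Normal_Form.Determinant"
begin

section \<open>Differential polynomials\<close>

definition derivation :: "('a::comm_ring \<Rightarrow> 'a) \<Rightarrow> bool" where
  "derivation d \<longleftrightarrow> (\<forall>a b. d (a + b) = d a + d b) \<and> (\<forall>a b. d (a * b) = d a * b + a * d b)"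

text \<open>\<open>Xv i k\<close> and \<open>Uv j k\<close> are the \<open>k\<close>-th derivatives of the differential indeterminates
  \<open>x\<^sub>i\<close> and \<open>u\<^sub>j\<close>.  The index \<open>i\<close> is meant to range over \<open>{1..n}\<close> and \<open>j\<close> over \<open>{1..n-1}\<close>; this
  is imposed where the rings \<open>K{X}\<close> and \<open>K{U}\<close> are formed, not by the type.\<close>
datatype dvar = Xv nat nat | Uv nat nat

fun dnext :: "dvar \<Rightarrow> dvar" where
  "dnext (Xv i k) = Xv i (Suc k)"
| "dnext (Uv j k) = Uv j (Suc k)"

type_synonym 'a dpoly = "(dvar \<Rightarrow>\<^sub>0 nat) \<Rightarrow>\<^sub>0 'a"

definition dconst :: "'a::comm_ring_1 \<Rightarrow> 'a dpoly" where
  "dconst c = Poly_Mapping.single 0 c"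

definition dvar_poly :: "dvar \<Rightarrow> 'a::comm_ring_1 dpoly" where
  "dvar_poly v = Poly_Mapping.single (Poly_Mapping.single v 1) 1"

definition vars :: "'a::comm_ring_1 dpoly \<Rightarrow> dvar set" where
  "vars f = (\<Union>m \<in> Poly_Mapping.keys f. Poly_Mapping.keys m)"

definition polys_in :: "dvar set \<Rightarrow> 'a::comm_ring_1 dpoly set" where
  "polys_in W = {f. vars f \<subseteq> W}"

definition X_vars :: "nat \<Rightarrow> dvar set" where
  "X_vars n = {Xv i k | i k. i \<in> {1..n}}"

definition U_vars :: "nat \<Rightarrow> dvar set" where
  "U_vars n = {Uv j k | j k. j \<in> {1..n-1}}"

text \<open>Total degree at most 1; constants are allowed.\<close>
definition linear_dpoly :: "'a::comm_ring_1 dpoly \<Rightarrow> bool" where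
  "linear_dpoly f \<longleftrightarrow> (\<forall>m \<in> Poly_Mapping.keys f. (\<Sum>v \<in> Poly_Mapping.keys m. Poly_Mapping.lookup m v) \<le> 1)"

text \<open>The derivation of the differential polynomial ring that extends the derivation \<open>d\<close> of the
  coefficients and sends every variable to its successor: a term \<open>c * m\<close> is mapped to
  \<open>d c * m + (\<Sum>v. c * m(v) * m/v * dnext v)\<close>, where \<open>m(v)\<close> is the exponent of \<open>v\<close> in \<open>m\<close>.\<close>
definition dp_deriv :: "('a::comm_ring_1 \<Rightarrow> 'a) \<Rightarrow> 'a dpoly \<Rightarrow> 'a dpoly" where
  "dp_deriv d f = (\<Sum>m \<in> Poly_Mapping.keys f. Poly_Mapping.single m (d (Poly_Mapping.lookup f m)) +
     (\<Sum>v \<in> Poly_Mapping.keys m. Poly_Mapping.single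
        (m - Poly_Mapping.single v 1 + Poly_Mapping.single (dnext v) 1)
        (of_nat (Poly_Mapping.lookup m v) * Poly_Mapping.lookup f m)))"

text \<open>Order in the differential indeterminate whose \<open>k\<close>-th derivative is \<open>y k\<close>.\<close>
definition dord :: "'a::comm_ring_1 dpoly \<Rightarrow> (nat \<Rightarrow> dvar) \<Rightarrow> int" where
  "dord f y = (if \<exists>k. y k \<in> vars f then int (Max {k. y k \<in> vars f}) else -1)"


section \<open>The linear complete differential resultant\<close>

text \<open>In this section \<open>F 1, \<dots>, F n\<close> is a system of \<open>n\<close> differential polynomials
  over a ring with derivation \<open>d\<close>.\<close>

definition ord_U :: "nat \<Rightarrow> 'a::comm_ring_1 dpoly \<Rightarrow> int" where
  "ord_U n f = Max (insert 0 ((\<lambda>j. dord f (Uv j)) ` {1..n-1}))"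

definition total_ord :: "nat \<Rightarrow> (nat \<Rightarrow> 'a::comm_ring_1 dpoly) \<Rightarrow> int" where
  "total_ord n F = (\<Sum>i\<in>{1..n}. ord_U n (F i))"

definition gamma_at :: "nat \<Rightarrow> (nat \<Rightarrow> 'a::comm_ring_1 dpoly) \<Rightarrow> nat \<Rightarrow> int" where
  "gamma_at n F j = Min ((\<lambda>i. ord_U n (F i) - dord (F i) (Uv j)) ` {1..n})"

definition gamma :: "nat \<Rightarrow> (nat \<Rightarrow> 'a::comm_ring_1 dpoly) \<Rightarrow> int" where
  "gamma n F = (\<Sum>j\<in>{1..n-1}. gamma_at n F j)"

definition PS :: "('a::comm_ring_1 \<Rightarrow> 'a) \<Rightarrow> nat \<Rightarrow> (nat \<Rightarrow> 'a dpoly) \<Rightarrow> 'a dpoly set" where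
  "PS d n F = {(dp_deriv d ^^ k) (F i) | i k.
     i \<in> {1..n} \<and> int k \<le> total_ord n F - ord_U n (F i) - gamma n F}"

definition PS_X_vars :: "nat \<Rightarrow> (nat \<Rightarrow> 'a::comm_ring_1 dpoly) \<Rightarrow> dvar set" where
  "PS_X_vars n F = {Xv i k | i k.
     i \<in> {1..n} \<and> int k \<le> total_ord n F - ord_U n (F i) - gamma n F}"

definition PS_U_vars :: "nat \<Rightarrow> (nat \<Rightarrow> 'a::comm_ring_1 dpoly) \<Rightarrow> dvar set" where
  "PS_U_vars n F = {Uv j k | j k.
     j \<in> {1..n-1} \<and> int k \<le> total_ord n F - gamma_at n F j - gamma n F}"

definition PS_rows :: "('a::comm_ring_1 \<Rightarrow> 'a) \<Rightarrow> nat \<Rightarrow> (nat \<Rightarrow> 'a dpoly) \<Rightarrow> 'a dpoly list" where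
  "PS_rows d n F = [(dp_deriv d ^^ k) (F i).
     i \<leftarrow> [1..<n+1],
     k \<leftarrow> rev [0..<nat (total_ord n F - ord_U n (F i) - gamma n F + 1)]]"

text \<open>The elements of \<open>PS_U_vars n F\<close> in decreasing order for the orderly ranking, i.e.\ by
  order of derivation first and then by index.  The order never exceeds \<open>total_ord n F\<close>
  because \<open>gamma_at\<close> is nonnegative.\<close>
definition PS_U_list :: "nat \<Rightarrow> (nat \<Rightarrow> 'a::comm_ring_1 dpoly) \<Rightarrow> dvar list" where
  "PS_U_list n F = [Uv j k.
     k \<leftarrow> rev [0..<nat (total_ord n F + 1)],
     j \<leftarrow> rev [1..<n],
     int k \<le> total_ord n F - gamma_at n F j - gamma n F]"

text \<open>Sum of the terms of \<open>f\<close> in which no derivative of any \<open>u\<^sub>j\<close> occurs.\<close>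
definition U_free_part :: "'a::comm_ring_1 dpoly \<Rightarrow> 'a dpoly" where
  "U_free_part f = (\<Sum>m \<in> {m \<in> Poly_Mapping.keys f. \<forall>j k. Uv j k \<notin> Poly_Mapping.keys m}. Poly_Mapping.single m (Poly_Mapping.lookup f m))"

text \<open>For linear \<open>f\<close> the coefficient of a variable \<open>v\<close> is the scalar
  \<open>Poly_Mapping.lookup f (single v 1)\<close>.\<close>
definition dCRes :: "('a::comm_ring_1 \<Rightarrow> 'a) \<Rightarrow> nat \<Rightarrow> (nat \<Rightarrow> 'a dpoly) \<Rightarrow> 'a dpoly" where
  "dCRes d n F =
     (let rows = PS_rows d n F; cols = PS_U_list n F; L = length rows
      in det (mat L L (\<lambda>(r, c).
           if c < L - 1 then dconst (Poly_Mapping.lookup (rows ! r) (Poly_Mapping.single (cols ! c) 1))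
           else U_free_part (rows ! r))))"

text \<open>The polynomial ring in the variables \<open>W\<close> as a ring with explicit carrier, so that ideals
  are generated inside it.\<close>
definition poly_ring :: "dvar set \<Rightarrow> 'a::comm_ring_1 dpoly ring" where
  "poly_ring W = \<lparr>carrier = polys_in W, monoid.mult = (*), one = 1, ring.zero = 0, add = (+)\<rparr>"


section \<open>Systems of DPPEs and their linear perturbations\<close>

definition dppe :: "(nat \<Rightarrow> 'a::comm_ring_1 dpoly) \<Rightarrow> nat \<Rightarrow> 'a dpoly" where
  "dppe P i = dvar_poly (Xv i 0) - P i"

text \<open>The field \<open>K\<^sub>p\<close> is the field of fractions of \<open>K[p]\<close>, of type \<open>'k poly fract\<close>.  As
  \<open>p\<close> is a constant, its derivation acts coefficientwise on \<open>K[p]\<close> and extends to fractions by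
  the quotient rule.\<close>
definition Kp_deriv :: "('k::field \<Rightarrow> 'k) \<Rightarrow> 'k poly fract \<Rightarrow> 'k poly fract" where
  "Kp_deriv d q =
     (let (a, b) = (SOME (a, b). b \<noteq> 0 \<and> q = Fract a b)
      in Fract (map_poly d a * b - a * map_poly d b) (b * b))"

definition Kp_indet :: "'k::field poly fract" where
  "Kp_indet = to_fract [:0, 1:]"

definition Kp_embed :: "'k::field dpoly \<Rightarrow> 'k poly fract dpoly" where
  "Kp_embed f = Poly_Mapping.map (\<lambda>c. to_fract [:c:]) f"

definition perturbed ::
  "(nat \<Rightarrow> 'k::field dpoly) \<Rightarrow> (nat \<Rightarrow> 'k dpoly) \<Rightarrow> nat \<Rightarrow> 'k poly fract dpoly" where
  "perturbed P \<phi> i = Kp_embed (dppe P i) - dconst Kp_indet * Kp_embed (\<phi> i)"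

text \<open>The coefficient of \<open>p ^ e\<close> in a differential polynomial over \<open>K\<^sub>p\<close> all of whose
  coefficients lie in \<open>K[p]\<close>; see \<open>p_coeff_expansion\<close> and \<open>Kp_polynomial_dCRes\<close> below.
  For other arguments the value is meaningless.\<close>
definition p_coeff :: "'k::field poly fract dpoly \<Rightarrow> nat \<Rightarrow> 'k dpoly" where
  "p_coeff R e = Poly_Mapping.map (\<lambda>q. coeff (inv_into UNIV to_fract q) e) R"

definition p_low_degree :: "'k::field poly fract dpoly \<Rightarrow> nat" where
  "p_low_degree R = (LEAST e. p_coeff R e \<noteq> 0)"


section \<open>The derivations are derivations\<close>

lemma poly_mapping_sum_monomials:
  "(\<Sum>m\<in>Poly_Mapping.keys f. Poly_Mapping.single m (Poly_Mapping.lookup f m)) = f"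
proof (rule poly_mapping_eqI)
  fix k
  show "Poly_Mapping.lookup (\<Sum>m\<in>Poly_Mapping.keys f. Poly_Mapping.single m (Poly_Mapping.lookup f m)) k
      = Poly_Mapping.lookup f k"
    by (simp add: lookup_sum lookup_single when_def in_keys_iff)
qed

lemma derivation_rules:
  assumes "derivation d"
  shows "d (a + b) = d a + d b" "d (a * b) = d a * b + a * d b" "d 0 = 0"
        "d (a - b) = d a - d b" "d (- a) = - d a"
proof -
  show add: "d (a + b) = d a + d b" for a b using assms by (auto simp: derivation_def)
  show "d (a * b) = d a * b + a * d b" using assms by (auto simp: derivation_def)
  show z: "d 0 = 0" using add[of 0 0] by simp
  show "d (- a) = - d a" for a using add[of a "-a"] z by (simp add: minus_unique)
  then show "d (a - b) = d a - d b" using add[of a "-b"] by simp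
qed

lemma derivation_map_poly:
  assumes "derivation (d :: 'k::field \<Rightarrow> 'k)"
  shows "derivation (map_poly d)"
proof -
  note r = derivation_rules[OF assms]
  have add: "map_poly d (a + b) = map_poly d a + map_poly d b" for a b
    by (rule poly_eqI) (simp add: coeff_map_poly r)
  have smult: "map_poly d (smult c b) = smult (d c) b + smult c (map_poly d b)" for c b
    by (rule poly_eqI) (simp add: coeff_map_poly r)
  have "map_poly d (a * b) = map_poly d a * b + a * map_poly d b" for a b
  proof (induction a)
    case 0
    then show ?case by simp
  next
    case (pCons c a)
    have p0: "map_poly d (pCons x q) = pCons (d x) (map_poly d q)" for x q
      by (rule poly_eqI) (simp add: coeff_map_poly r coeff_pCons split: nat.split)
    show ?case
      by (simp add: p0 add smult pCons.IH r algebra_simps)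
  qed
  with add show ?thesis by (auto simp: derivation_def)
qed

lemma quotient_rule_unique:
  fixes a b a' b' x y x' y' :: "'a::comm_ring_1"
  assumes "a * b' = a' * b" and "x * b' + a * y' = x' * b + a' * y"
  shows "(x * b - a * y) * (b' * b') = (x' * b' - a' * y') * (b * b)"
proof -
  have "(x * b - a * y) * (b' * b') = (x * b' + a * y') * (b * b') - (a * b') * (b * y' + b' * y)"
    by (simp add: algebra_simps)
  also have "\<dots> = (x' * b + a' * y) * (b * b') - (a' * b) * (b * y' + b' * y)"
    by (simp only: assms)
  also have "\<dots> = (x' * b' - a' * y') * (b * b)"
    by (simp add: algebra_simps)
  finally show ?thesis .
qed

lemma Kp_deriv_Fract:
  fixes d :: "'k::field \<Rightarrow> 'k"
  assumes "derivation d" and "b \<noteq> 0"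
  shows "Kp_deriv d (Fract a b) = Fract (map_poly d a * b - a * map_poly d b) (b * b)"
proof -
  note r = derivation_rules[OF derivation_map_poly[OF assms(1)]]
  define s where "s = (SOME (a', b'). b' \<noteq> 0 \<and> Fract a b = Fract a' b')"
  obtain a' b' where s: "s = (a', b')" by (cases s)
  have "case s of (a', b') \<Rightarrow> b' \<noteq> 0 \<and> Fract a b = Fract a' b'"
    unfolding s_def by (rule someI[of _ "(a, b)"]) (use assms in simp)
  then have b': "b' \<noteq> 0" and "Fract a b = Fract a' b'" by (simp_all add: s)
  then have e: "a * b' = a' * b" using assms(2) by (simp add: eq_fract)
  let ?D = "map_poly d"
  have e': "?D a * b' + a * ?D b' = ?D a' * b + a' * ?D b"
    using arg_cong[OF e, of ?D] by (simp add: r)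
  have "(?D a * b - a * ?D b) * (b' * b') = (?D a' * b' - a' * ?D b') * (b * b)"
    using quotient_rule_unique[OF e e'] .
  then show ?thesis
    unfolding Kp_deriv_def s_def[symmetric] s using assms(2) b' by (simp add: eq_fract)
qed

lemma derivation_Kp_deriv:
  fixes d :: "'k::field \<Rightarrow> 'k"
  assumes "derivation d"
  shows "derivation (Kp_deriv d)"
proof -
  note r = derivation_rules[OF derivation_map_poly[OF assms]]
  let ?D = "map_poly d"
  have "Kp_deriv d (x + y) = Kp_deriv d x + Kp_deriv d y
      \<and> Kp_deriv d (x * y) = Kp_deriv d x * y + x * Kp_deriv d y" for x y
  proof -
    obtain a b where x: "x = Fract a b" "b \<noteq> 0" by (cases x)
    obtain a' b' where y: "y = Fract a' b'" "b' \<noteq> 0" by (cases y)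
    show ?thesis
      using x(2) y(2) by (simp add: x(1) y(1) Kp_deriv_Fract[OF assms] r eq_fract) (auto simp: algebra_simps)
  qed
  then show ?thesis by (simp add: derivation_def)
qed

lemma Kp_deriv_to_fract:
  fixes d :: "'k::field \<Rightarrow> 'k"
  assumes "derivation d"
  shows "Kp_deriv d (to_fract a) = to_fract (map_poly d a)"
proof -
  have "map_poly d 1 = (0 :: 'k poly)"
    using derivation_rules(2)[OF derivation_map_poly[OF assms], of 1 1]
    by (metis add_cancel_left_right mult.right_neutral mult_1)
  then show ?thesis by (simp add: to_fract_def Kp_deriv_Fract[OF assms])
qed

definition mon_deriv :: "(dvar \<Rightarrow>\<^sub>0 nat) \<Rightarrow> 'a::comm_ring_1 dpoly" where
  "mon_deriv m = (\<Sum>v \<in> Poly_Mapping.keys m. Poly_Mapping.single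
        (m - Poly_Mapping.single v 1 + Poly_Mapping.single (dnext v) 1) (of_nat (Poly_Mapping.lookup m v)))"

lemma mon_deriv_superset:
  assumes "finite S" "Poly_Mapping.keys m \<subseteq> S"
  shows "mon_deriv m = (\<Sum>v \<in> S. Poly_Mapping.single
        (m - Poly_Mapping.single v 1 + Poly_Mapping.single (dnext v) 1) (of_nat (Poly_Mapping.lookup m v)))"
  unfolding mon_deriv_def
  by (rule sum.mono_neutral_left) (use assms in \<open>auto simp: in_keys_iff\<close>)

lemma mon_deriv_add:
  "mon_deriv (m1 + m2) = mon_deriv m1 * Poly_Mapping.single m2 (1::'a::comm_ring_1)
     + Poly_Mapping.single m1 1 * mon_deriv m2"
proof -
  let ?S = "Poly_Mapping.keys m1 \<union> Poly_Mapping.keys m2"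
  let ?s = "\<lambda>m v. m - Poly_Mapping.single v 1 + Poly_Mapping.single (dnext v) (1::nat)"
  have sub: "Poly_Mapping.single (?s (m + m') v) (of_nat (Poly_Mapping.lookup m v) :: 'a)
      = Poly_Mapping.single (?s m v) (of_nat (Poly_Mapping.lookup m v)) * Poly_Mapping.single m' 1" for m m' v
  proof (cases "Poly_Mapping.lookup m v = 0")
    case False
    then have "?s (m + m') v = ?s m v + m'"
      by (intro poly_mapping_eqI) (auto simp: lookup_add lookup_minus lookup_single when_def)
    then show ?thesis by (simp add: mult_single)
  qed simp
  have "mon_deriv (m1 + m2) = (\<Sum>v\<in>?S. Poly_Mapping.single (?s (m1 + m2) v) (of_nat (Poly_Mapping.lookup (m1 + m2) v) :: 'a))"
    by (rule mon_deriv_superset) (use keys_add[of m1 m2] in auto)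
  also have "\<dots> = (\<Sum>v\<in>?S. Poly_Mapping.single (?s (m1 + m2) v) (of_nat (Poly_Mapping.lookup m1 v) :: 'a))
      + (\<Sum>v\<in>?S. Poly_Mapping.single (?s (m2 + m1) v) (of_nat (Poly_Mapping.lookup m2 v) :: 'a))"
    by (simp add: lookup_add single_add sum.distrib add.commute)
  also have "\<dots> = mon_deriv m1 * Poly_Mapping.single m2 1 + mon_deriv m2 * Poly_Mapping.single m1 1"
    unfolding sub mon_deriv_superset[of ?S m1, OF finite_UnI[OF finite_keys finite_keys] Un_upper1]
      mon_deriv_superset[of ?S m2, OF finite_UnI[OF finite_keys finite_keys] Un_upper2]
      sum_distrib_right ..
  finally show ?thesis by (simp add: mult.commute)
qed

lemma dp_deriv_alt:
  "dp_deriv d f = (\<Sum>m \<in> Poly_Mapping.keys f. Poly_Mapping.single m (d (Poly_Mapping.lookup f m))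
     + dconst (Poly_Mapping.lookup f m) * mon_deriv m)"
  by (simp add: dp_deriv_def mon_deriv_def dconst_def sum_distrib_left mult_single mult.commute)

context
  fixes d :: "'a::comm_ring_1 \<Rightarrow> 'a"
  assumes d: "derivation d"
begin

lemma dp_deriv_superset:
  assumes "finite S" "Poly_Mapping.keys f \<subseteq> S"
  shows "dp_deriv d f = (\<Sum>m \<in> S. Poly_Mapping.single m (d (Poly_Mapping.lookup f m))
     + dconst (Poly_Mapping.lookup f m) * mon_deriv m)"
  unfolding dp_deriv_alt
  by (rule sum.mono_neutral_left)
     (use assms in \<open>auto simp: in_keys_iff dconst_def derivation_rules[OF d]\<close>)

lemma dp_deriv_add: "dp_deriv d (f + g) = dp_deriv d f + dp_deriv d g"
proof -
  let ?S = "Poly_Mapping.keys f \<union> Poly_Mapping.keys g"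
  show ?thesis
    using dp_deriv_superset[of ?S f] dp_deriv_superset[of ?S g] dp_deriv_superset[of ?S "f + g"]
      keys_add[of f g]
    by (simp add: lookup_add derivation_rules[OF d] dconst_def single_add sum.distrib algebra_simps)
qed

lemma dp_deriv_single:
  "dp_deriv d (Poly_Mapping.single m c) = Poly_Mapping.single m (d c) + dconst c * mon_deriv m"
  using dp_deriv_superset[of "{m}" "Poly_Mapping.single m c"] by simp

lemma dp_deriv_0: "dp_deriv d 0 = 0"
  by (simp add: dp_deriv_def)

lemma dp_deriv_mult_single:
  "dp_deriv d (Poly_Mapping.single m c * Poly_Mapping.single m' c')
     = dp_deriv d (Poly_Mapping.single m c) * Poly_Mapping.single m' c'
       + Poly_Mapping.single m c * dp_deriv d (Poly_Mapping.single m' c')"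
proof -
  define S S' where "S = Poly_Mapping.single m (1::'a)" and "S' = Poly_Mapping.single m' (1::'a)"
  have s: "Poly_Mapping.single m x = dconst x * S" "Poly_Mapping.single m' x = dconst x * S'"
    "Poly_Mapping.single (m + m') x = dconst x * (S * S')" for x
    by (simp_all add: dconst_def S_def S'_def mult_single)
  have dc: "dconst (a * b) = dconst a * dconst b" "dconst (a + b) = dconst a + dconst b"
    "dconst 1 = (1::'a dpoly)" for a b :: 'a
    by (simp_all add: dconst_def mult_single single_add)
  show ?thesis
    unfolding mult_single dp_deriv_single
    unfolding mon_deriv_add derivation_rules(2)[OF d]
    unfolding s dc
    by (simp add: algebra_simps)
qed

lemma dp_deriv_sum: "dp_deriv d (sum g S) = (\<Sum>s\<in>S. dp_deriv d (g s))"
  by (induction S rule: infinite_finite_induct) (simp_all add: dp_deriv_0 dp_deriv_add)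

lemma derivation_dp_deriv: "derivation (dp_deriv d)"
proof -
  have ex: "\<exists>S c. finite S \<and> h = (\<Sum>m\<in>S. Poly_Mapping.single m (c m))" for h :: "'a dpoly"
    by (intro exI[of _ "Poly_Mapping.keys h"] exI[of _ "Poly_Mapping.lookup h"])
       (simp add: poly_mapping_sum_monomials)
  have "dp_deriv d (f * g) = dp_deriv d f * g + f * dp_deriv d g" for f g
  proof -
    obtain S c where f: "f = (\<Sum>m\<in>S. Poly_Mapping.single m (c m))"
      using ex by blast
    obtain T e where g: "g = (\<Sum>m\<in>T. Poly_Mapping.single m (e m))"
      using ex by blast
    show ?thesis
      unfolding f g sum_product dp_deriv_sum dp_deriv_mult_single sum.distrib ..
  qed
  then show ?thesis
    by (simp add: derivation_def dp_deriv_add)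
qed

lemma dp_deriv_dconst: "dp_deriv d (dconst c) = dconst (d c)"
  by (simp add: dp_deriv_single[of 0] dconst_def mon_deriv_def)

lemma dp_deriv_dvar_poly: "dp_deriv d (dvar_poly v) = dvar_poly (dnext v)"
proof -
  have "d 1 = 0"
    using derivation_rules(2)[OF d, of 1 1] by (metis add_cancel_left_right mult.right_neutral mult_1)
  then show ?thesis
    by (simp add: dvar_poly_def dp_deriv_single mon_deriv_def dconst_def)
qed

end


section \<open>The differential resultant of a perturbed system is a polynomial in \<open>p\<close>\<close>

definition Kp_polynomial :: "'k::field poly fract dpoly \<Rightarrow> bool" where
  "Kp_polynomial f \<longleftrightarrow> (\<forall>m. Poly_Mapping.lookup f m \<in> range to_fract)"

lemma lookup_p_coeff:
  assumes "Poly_Mapping.lookup R m = to_fract q"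
  shows "Poly_Mapping.lookup (p_coeff R e) m = coeff q e"
proof -
  have "inv_into UNIV to_fract (to_fract q) = q"
    by (rule inv_into_f_f) (simp_all add: inj_def)
  then show ?thesis
    using assms by (simp add: p_coeff_def Poly_Mapping.map.rep_eq when_def)
qed

lemma lookup_Kp_embed: "Poly_Mapping.lookup (Kp_embed f) m = to_fract [:Poly_Mapping.lookup f m:]"
  by (simp add: Kp_embed_def Poly_Mapping.map.rep_eq when_def)

lemma lookup_dconst_mult:
  "Poly_Mapping.lookup (dconst c * f) m = c * Poly_Mapping.lookup f m"
proof -
  have "dconst c * f = (\<Sum>k\<in>Poly_Mapping.keys f. Poly_Mapping.single k (c * Poly_Mapping.lookup f k))"
    by (subst (1) poly_mapping_sum_monomials[of f, symmetric])
       (simp add: sum_distrib_left dconst_def mult_single)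
  then show ?thesis
    by (simp add: lookup_sum lookup_single when_def in_keys_iff)
qed

lemma p_coeff_expansion:
  fixes R :: "'k::field poly fract dpoly"
  assumes "Kp_polynomial R"
  shows "\<exists>N. \<forall>n\<ge>N. R = (\<Sum>e\<le>n. dconst Kp_indet ^ e * Kp_embed (p_coeff R e))"
proof -
  have "\<exists>q. \<forall>m. Poly_Mapping.lookup R m = to_fract (q m)"
    by (rule choice) (use assms in \<open>simp add: Kp_polynomial_def image_iff\<close>)
  then obtain q where q: "\<And>m. Poly_Mapping.lookup R m = to_fract (q m)"
    by blast
  define N where "N = Max (insert 0 ((\<lambda>m. degree (q m)) ` Poly_Mapping.keys R))"
  have deg: "degree (q m) \<le> N" for m
  proof (cases "m \<in> Poly_Mapping.keys R")
    case True
    then show ?thesis unfolding N_def by (intro Max_ge) auto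
  next
    case False
    then have "q m = 0" using q[of m] by (simp add: in_keys_iff)
    then show ?thesis by simp
  qed
  have pw: "dconst c ^ e = dconst (c ^ e)" for c :: "'k poly fract" and e
    by (induction e) (simp_all add: dconst_def mult_single)
  have tp: "to_fract x ^ e = to_fract (x ^ e)" for x :: "'k poly" and e
    by (induction e) simp_all
  have ts: "(\<Sum>e\<in>S. to_fract (g e)) = to_fract (sum g S)" for g :: "nat \<Rightarrow> 'k poly" and S
    by (induction S rule: infinite_finite_induct) simp_all
  have "R = (\<Sum>e\<le>n. dconst Kp_indet ^ e * Kp_embed (p_coeff R e))" if "n \<ge> N" for n
  proof (rule poly_mapping_eqI)
    fix m
    have "Poly_Mapping.lookup (\<Sum>e\<le>n. dconst Kp_indet ^ e * Kp_embed (p_coeff R e)) m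
        = (\<Sum>e\<le>n. to_fract (monom (coeff (q m) e) e))"
      by (simp add: lookup_sum pw lookup_dconst_mult Kp_indet_def tp lookup_Kp_embed
          lookup_p_coeff[OF q] monom_altdef flip: to_fract_mult)
    also have "\<dots> = to_fract (\<Sum>e\<le>n. monom (coeff (q m) e) e)"
      by (rule ts)
    also have "\<dots> = to_fract (q m)"
      by (subst poly_as_sum_of_monoms') (use deg[of m] that in auto)
    finally show "Poly_Mapping.lookup R m
        = Poly_Mapping.lookup (\<Sum>e\<le>n. dconst Kp_indet ^ e * Kp_embed (p_coeff R e)) m"
      by (simp add: q)
  qed
  then show ?thesis by blast
qed

lemma range_to_fract_closed:
  assumes "x \<in> range to_fract" "y \<in> range to_fract"
  shows "x + y \<in> range to_fract" "x * y \<in> range to_fract" "x - y \<in> range to_fract"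
  using assms by (auto simp flip: to_fract_add to_fract_mult to_fract_diff)

lemma zero_one_in_range_to_fract: "0 \<in> range to_fract" "1 \<in> range to_fract"
  by (rule range_eqI, rule to_fract_0[symmetric], rule range_eqI, rule to_fract_1[symmetric])

lemma of_nat_in_range_to_fract: "of_nat k \<in> range to_fract"
  by (induction k) (simp_all add: range_to_fract_closed zero_one_in_range_to_fract)

lemma Kp_polynomial_single: "c \<in> range to_fract \<Longrightarrow> Kp_polynomial (Poly_Mapping.single m c)"
  by (simp add: Kp_polynomial_def lookup_single when_def zero_one_in_range_to_fract)

lemma Kp_polynomial_0: "Kp_polynomial 0"
  by (simp add: Kp_polynomial_def zero_one_in_range_to_fract)

lemma Kp_polynomial_add: "Kp_polynomial f \<Longrightarrow> Kp_polynomial g \<Longrightarrow> Kp_polynomial (f + g)"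
  by (simp add: Kp_polynomial_def lookup_add range_to_fract_closed)

lemma Kp_polynomial_diff: "Kp_polynomial f \<Longrightarrow> Kp_polynomial g \<Longrightarrow> Kp_polynomial (f - g)"
  by (simp add: Kp_polynomial_def lookup_minus range_to_fract_closed)

lemma Kp_polynomial_sum: "(\<And>s. s \<in> S \<Longrightarrow> Kp_polynomial (g s)) \<Longrightarrow> Kp_polynomial (sum g S)"
  by (induction S rule: infinite_finite_induct) (simp_all add: Kp_polynomial_0 Kp_polynomial_add)

lemma Kp_polynomial_mult:
  assumes "Kp_polynomial f" "Kp_polynomial g"
  shows "Kp_polynomial (f * g)"
proof -
  have "f * g = (\<Sum>m\<in>Poly_Mapping.keys f. Poly_Mapping.single m (Poly_Mapping.lookup f m)) *
      (\<Sum>m\<in>Poly_Mapping.keys g. Poly_Mapping.single m (Poly_Mapping.lookup g m))"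
    by (simp add: poly_mapping_sum_monomials)
  also have "Kp_polynomial \<dots>"
    unfolding sum_product mult_single
    by (intro Kp_polynomial_sum Kp_polynomial_single range_to_fract_closed)
       (use assms in \<open>auto simp: Kp_polynomial_def\<close>)
  finally show ?thesis .
qed

lemma Kp_polynomial_prod: "(\<And>s. s \<in> S \<Longrightarrow> Kp_polynomial (g s)) \<Longrightarrow> Kp_polynomial (prod g S)"
  by (induction S rule: infinite_finite_induct)
     (simp_all add: Kp_polynomial_mult, auto intro: Kp_polynomial_single zero_one_in_range_to_fract simp flip: single_one)

lemma Kp_polynomial_deriv:
  assumes "derivation d" "Kp_polynomial f"
  shows "Kp_polynomial (dp_deriv (Kp_deriv d) f)"
  unfolding dp_deriv_def
proof (intro Kp_polynomial_sum Kp_polynomial_add Kp_polynomial_single range_to_fract_closed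
    of_nat_in_range_to_fract)
  fix m
  show l: "Poly_Mapping.lookup f m \<in> range to_fract"
    using assms(2) by (simp add: Kp_polynomial_def)
  then show "Kp_deriv d (Poly_Mapping.lookup f m) \<in> range to_fract"
    by (auto simp: Kp_deriv_to_fract[OF assms(1)])
qed

lemma Kp_polynomial_perturbed: "Kp_polynomial (perturbed P \<phi> i)"
proof -
  have "Kp_polynomial (Kp_embed f)" for f :: "'a dpoly"
    by (auto simp: Kp_polynomial_def Kp_embed_def Poly_Mapping.map.rep_eq when_def
        zero_one_in_range_to_fract)
  then show ?thesis
    unfolding perturbed_def dconst_def Kp_indet_def
    by (intro Kp_polynomial_diff Kp_polynomial_mult Kp_polynomial_single) auto
qed

lemma Kp_polynomial_dCRes:
  assumes "derivation d"
  shows "Kp_polynomial (dCRes (Kp_deriv d) n (perturbed P \<phi>))"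
proof -
  have it: "Kp_polynomial ((dp_deriv (Kp_deriv d) ^^ k) (perturbed P \<phi> i))" for k i
    by (induction k) (simp_all add: Kp_polynomial_perturbed Kp_polynomial_deriv[OF assms])
  define rows where "rows = PS_rows (Kp_deriv d) n (perturbed P \<phi>)"
  have rows: "Kp_polynomial (rows ! r)" if "r < length rows" for r
  proof -
    have "rows ! r \<in> set rows" using that by simp
    then show ?thesis unfolding rows_def PS_rows_def using it by auto
  qed
  have sign: "Kp_polynomial (signof \<pi>)" for \<pi> :: "nat \<Rightarrow> nat"
    unfolding sign_def
    by (auto intro!: Kp_polynomial_single Kp_polynomial_diff[of 0, simplified] Kp_polynomial_0
        zero_one_in_range_to_fract simp flip: single_one)
  show ?thesis
    unfolding dCRes_def Let_def rows_def[symmetric] det_def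
    apply (simp add: if_distrib)
    apply (intro Kp_polynomial_sum Kp_polynomial_mult Kp_polynomial_prod sign)
    subgoal for \<pi> i
      using permutes_in_image[of \<pi> "{0..<length rows}" i] rows[of i]
      by (auto simp: dconst_def U_free_part_def Kp_polynomial_def[of "rows ! i"]
          intro!: Kp_polynomial_single Kp_polynomial_sum)
    done
qed

end

theory Submission
  imports Defs
begin

text \<open>Write the \<open>r\<close>-th row polynomial of the perturbed system as \<open>f\<^sub>r - p * g\<^sub>r\<close>, where
  \<open>f\<^sub>r = \<partial>\<^sup>k F\<^sub>i\<close> runs through \<open>PS\<close> and \<open>g\<^sub>r = \<partial>\<^sup>k \<phi>\<^sub>i\<close>; this splitting survives derivation because
  \<open>p\<close> is a constant.  The row polynomial is linear and its derivatives of the \<open>u\<^sub>j\<close> are all among the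
  columns, so adding to the last column the multiples \<open>v\<close> of the columns belonging to the variables \<open>v\<close>
  turns its entries into the row polynomials themselves.  Expanding along the last column then gives
  \<open>R = (\<Sum>r. C\<^sub>r * (f\<^sub>r - p * g\<^sub>r))\<close>
  for the resultant \<open>R\<close>, and the cofactors \<open>C\<^sub>r\<close> are elements of \<open>K[p]\<close>, because they involve only the
  coefficient columns (\<open>det_eliminate_columns\<close>, \<open>cofactor_map_mat_hom\<close>).

  Let \<open>p\<^sup>a\<close> be the lowest power of \<open>p\<close> that occurs in any \<open>C\<^sub>r\<close>, and \<open>c\<^sub>r\<close> its coefficient in \<open>C\<^sub>r\<close>.
  The summands \<open>p * g\<^sub>r\<close> only contribute from \<open>p\<^sup>a * p\<close> on, so below \<open>p\<^sup>a\<close> the coefficients of \<open>R\<close> vanish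
  and that of \<open>p\<^sup>a\<close> is \<open>\<Sum>r. c\<^sub>r * f\<^sub>r\<close>.  This sum is not zero: the \<open>f\<^sub>r\<close> are linearly independent over
  \<open>K\<close>, as \<open>\<partial>\<^sup>k F\<^sub>i\<close> is the only one in which \<open>x\<^sub>i\<^sub>k\<close> occurs.  Hence it is the lowest coefficient of \<open>R\<close>
  (\<open>p_coeff_lowest_combination\<close>), and it is visibly linear and in the ideal of \<open>PS\<close>.  It is free of
  \<open>U\<close> because \<open>R\<close> is: the last column of the matrix contains only terms without \<open>U\<close>, and the other
  columns contain constants.

  What remains is bookkeeping: the matrix has exactly one row more than there are variables in \<open>\<V>\<close>
  (\<open>length_row_index_eq_Suc_columns\<close>), and the orders of the rows fit into \<open>\<V>\<close>
  (\<open>Uv_deriv_iterate_in_PS_U_vars\<close>).\<close>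


section \<open>Linear differential polynomials and their derivatives\<close>

text \<open>A monomial of total degree at most 1 is either 1 or a single variable; this turns the degree
  condition into a case distinction.\<close>
lemma linear_dpoly_iff:
  "linear_dpoly f \<longleftrightarrow> (\<forall>m\<in>Poly_Mapping.keys f. m = 0 \<or> (\<exists>v. m = Poly_Mapping.single v 1))"
proof -
  have "(\<Sum>v\<in>Poly_Mapping.keys m. Poly_Mapping.lookup m v) \<le> 1 \<longleftrightarrow>
      m = 0 \<or> (\<exists>v. m = Poly_Mapping.single v 1)" (is "?s \<le> 1 \<longleftrightarrow> _") for m :: "dvar \<Rightarrow>\<^sub>0 nat"
  proof
    assume le: "?s \<le> 1"
    show "m = 0 \<or> (\<exists>v. m = Poly_Mapping.single v 1)"
    proof (rule disjCI)
      assume "\<nexists>v. m = Poly_Mapping.single v 1"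
      show "m = 0"
      proof (rule ccontr)
        assume "m \<noteq> 0"
        then obtain v where v: "v \<in> Poly_Mapping.keys m" by (metis ex_in_conv keys_eq_empty)
        have split: "?s = Poly_Mapping.lookup m v + (\<Sum>w\<in>Poly_Mapping.keys m - {v}. Poly_Mapping.lookup m w)"
          by (rule sum.remove) (use v in auto)
        have "Poly_Mapping.lookup m v > 0" using v by (simp add: in_keys_iff)
        then have one: "Poly_Mapping.lookup m v = 1"
          and "(\<Sum>w\<in>Poly_Mapping.keys m - {v}. Poly_Mapping.lookup m w) = 0"
          using le split by linarith+
        then have "\<forall>w\<in>Poly_Mapping.keys m - {v}. Poly_Mapping.lookup m w = 0"
          by (metis finite_Diff finite_keys sum_eq_0_iff)
        then have "w = v" if "w \<in> Poly_Mapping.keys m" for w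
          using that by (metis Diff_iff in_keys_iff singletonD)
        then have "m = Poly_Mapping.single v 1"
          using one by (intro poly_mapping_eqI) (auto simp: lookup_single when_def in_keys_iff)
        then show False using \<open>\<nexists>v. m = Poly_Mapping.single v 1\<close> by blast
      qed
    qed
  next
    assume "m = 0 \<or> (\<exists>v. m = Poly_Mapping.single v 1)"
    then show "?s \<le> 1" by (elim disjE exE) simp_all
  qed
  then show ?thesis by (simp only: linear_dpoly_def)
qed

lemma linear_dpoly_subset:
  "linear_dpoly f \<Longrightarrow> Poly_Mapping.keys g \<subseteq> Poly_Mapping.keys f \<Longrightarrow> linear_dpoly g"
  unfolding linear_dpoly_def by blast

lemma linear_dpoly_diff: "linear_dpoly f \<Longrightarrow> linear_dpoly g \<Longrightarrow> linear_dpoly (f - g)"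
  unfolding linear_dpoly_def using keys_diff[of f g] by blast

lemma linear_dpoly_sum: "(\<And>s. s \<in> S \<Longrightarrow> linear_dpoly (h s)) \<Longrightarrow> linear_dpoly (sum h S)"
  unfolding linear_dpoly_def using keys_sum[of h S] by blast

lemma keys_dconst_mult: "Poly_Mapping.keys (dconst c * f) \<subseteq> Poly_Mapping.keys f"
  by (auto simp: in_keys_iff lookup_dconst_mult)

lemma linear_dpoly_dconst_mult: "linear_dpoly f \<Longrightarrow> linear_dpoly (dconst c * f)"
  by (rule linear_dpoly_subset[OF _ keys_dconst_mult])

lemma linear_dpoly_dvar_poly: "linear_dpoly (dvar_poly v)"
  by (auto simp: linear_dpoly_iff dvar_poly_def)

lemma vars_diff: "vars (f - g) \<subseteq> vars f \<union> vars g"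
  unfolding vars_def using keys_diff[of f g] by blast

lemma vars_subset_keys: "Poly_Mapping.keys g \<subseteq> Poly_Mapping.keys f \<Longrightarrow> vars g \<subseteq> vars f"
  unfolding vars_def by blast

lemma lookup_single_not_vars:
  assumes "v \<notin> vars f"
  shows "Poly_Mapping.lookup f (Poly_Mapping.single v 1) = 0"
proof (rule ccontr)
  assume "Poly_Mapping.lookup f (Poly_Mapping.single v 1) \<noteq> 0"
  then have "Poly_Mapping.single v 1 \<in> Poly_Mapping.keys f" by (simp add: in_keys_iff)
  moreover have "v \<in> Poly_Mapping.keys (Poly_Mapping.single v (1::nat))" by simp
  ultimately show False using assms unfolding vars_def by blast
qed

lemma vars_dvar_poly: "vars (dvar_poly v) = {v}"
  by (simp add: vars_def dvar_poly_def)

text \<open>Derivation either keeps a monomial (differentiating its coefficient) or replaces one factor of it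
  by the successor.  Linearity and the bounds on the variables of derivatives all come from this.\<close>
lemma keys_dp_deriv:
  "Poly_Mapping.keys (dp_deriv d f) \<subseteq> (\<Union>m\<in>Poly_Mapping.keys f. insert m
     ((\<lambda>v. m - Poly_Mapping.single v 1 + Poly_Mapping.single (dnext v) 1) ` Poly_Mapping.keys m))"
  unfolding dp_deriv_def
  by (intro order.trans[OF keys_sum] UN_mono order.trans[OF keys_add] Un_least)
     (auto dest!: subsetD[OF keys_sum] split: if_splits)

lemma linear_dpoly_deriv:
  assumes "linear_dpoly f"
  shows "linear_dpoly (dp_deriv d f)"
  unfolding linear_dpoly_iff
proof
  fix m assume "m \<in> Poly_Mapping.keys (dp_deriv d f)"
  then obtain m' where "m' \<in> Poly_Mapping.keys f" and m: "m = m' \<or>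
      m \<in> (\<lambda>v. m' - Poly_Mapping.single v 1 + Poly_Mapping.single (dnext v) 1) ` Poly_Mapping.keys m'"
    using keys_dp_deriv[of d f] by blast
  then have "m' = 0 \<or> (\<exists>v. m' = Poly_Mapping.single v 1)"
    using assms by (auto simp: linear_dpoly_iff)
  then show "m = 0 \<or> (\<exists>v. m = Poly_Mapping.single v 1)"
    using m by auto
qed

lemma linear_dpoly_deriv_iterate: "linear_dpoly f \<Longrightarrow> linear_dpoly ((dp_deriv d ^^ k) f)"
  by (induction k) (auto intro: linear_dpoly_deriv)

lemma vars_dp_deriv: "vars (dp_deriv d f) \<subseteq> vars f \<union> dnext ` vars f"
proof
  fix w assume "w \<in> vars (dp_deriv d f)"
  then obtain m where m: "m \<in> Poly_Mapping.keys (dp_deriv d f)" and w: "w \<in> Poly_Mapping.keys m"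
    by (auto simp: vars_def)
  then obtain m' where m': "m' \<in> Poly_Mapping.keys f" "m = m' \<or>
      m \<in> (\<lambda>v. m' - Poly_Mapping.single v 1 + Poly_Mapping.single (dnext v) 1) ` Poly_Mapping.keys m'"
    using keys_dp_deriv[of d f] by blast
  show "w \<in> vars f \<union> dnext ` vars f"
  proof (cases "m = m'")
    case True
    then show ?thesis using m' w by (auto simp: vars_def)
  next
    case False
    then obtain v where v: "v \<in> Poly_Mapping.keys m'"
      and "m = m' - Poly_Mapping.single v 1 + Poly_Mapping.single (dnext v) 1"
      using m' by blast
    then have "w \<in> Poly_Mapping.keys m' \<or> w = dnext v"
      using w by (auto simp: in_keys_iff lookup_add lookup_minus lookup_single when_def split: if_splits)
    then show ?thesis using v m' by (auto simp: vars_def)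
  qed
qed

lemma vars_dp_deriv_iterate:
  "vars ((dp_deriv d ^^ k) f) \<subseteq> (\<Union>l\<le>k. (dnext ^^ l) ` vars f)"
proof (induction k)
  case (Suc k)
  have "vars ((dp_deriv d ^^ Suc k) f) \<subseteq> (\<Union>l\<le>k. (dnext ^^ l) ` vars f) \<union> dnext ` (\<Union>l\<le>k. (dnext ^^ l) ` vars f)"
    using order.trans[OF vars_dp_deriv[of d "(dp_deriv d ^^ k) f"] Un_mono[OF Suc image_mono[OF Suc]]]
    by simp
  also have "dnext ` (\<Union>l\<le>k. (dnext ^^ l) ` vars f) = (\<Union>l\<le>k. (dnext ^^ Suc l) ` vars f)"
    by (simp add: image_UN image_comp o_def)
  also have "(\<Union>l\<le>k. (dnext ^^ l) ` vars f) \<union> (\<Union>l\<le>k. (dnext ^^ Suc l) ` vars f)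
      \<subseteq> (\<Union>l\<le>Suc k. (dnext ^^ l) ` vars f)"
    by (intro Un_least UN_least UN_upper) auto
  finally show ?case .
qed simp

lemma dnext_iterate:
  "(dnext ^^ l) (Xv i k) = Xv i (k + l)" "(dnext ^^ l) (Uv i k) = Uv i (k + l)"
  by (induction l) simp_all

lemma vars_deriv_iterate_closed:
  assumes "vars f \<subseteq> W" "dnext ` W \<subseteq> W"
  shows "vars ((dp_deriv d ^^ k) f) \<subseteq> W"
proof (induction k)
  case (Suc k)
  then show ?case using vars_dp_deriv[of d "(dp_deriv d ^^ k) f"] assms(2) by simp blast
qed (use assms in simp)

lemma finite_vars: "finite (vars f)"
  by (simp add: vars_def)

lemma finite_orders: "finite {k. Uv j k \<in> vars f}"
  by (rule finite_subset[OF _ finite_vimageI[OF finite_vars[of f], of "Uv j"]]) (auto simp: inj_def)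

lemma dord_ge: "Uv j k \<in> vars f \<Longrightarrow> int k \<le> dord f (Uv j)"
  unfolding dord_def using Max_ge[OF finite_orders[of j f], of k] by auto

text \<open>Each derivation raises the order by at most one.\<close>
lemma Uv_deriv_iterate_dord:
  assumes "Uv j l \<in> vars ((dp_deriv d ^^ k) f)"
  shows "int l \<le> dord f (Uv j) + int k"
proof -
  obtain t v where v: "v \<in> vars f" "Uv j l = (dnext ^^ t) v" "t \<le> k"
    using assms vars_dp_deriv_iterate[of k d f] by blast
  then obtain s where "v = Uv j s" "l = s + t"
    by (cases v) (auto simp: dnext_iterate)
  then show ?thesis using dord_ge[of j s f] v by simp
qed

text \<open>For a linear polynomial nothing but the coefficients of the \<open>u\<^sub>j\<^sub>k\<close> and the terms free of \<open>U\<close> is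
  left, so a row of the resultant matrix determines the polynomial that it lists, provided that the
  columns \<open>S\<close> comprise all the \<open>u\<^sub>j\<^sub>k\<close> that occur.\<close>
lemma linear_dpoly_eq_U_part:
  assumes lin: "linear_dpoly f" and fin: "finite S"
    and S: "S \<subseteq> range (case_prod Uv)" "\<And>j k. Uv j k \<in> vars f \<Longrightarrow> Uv j k \<in> S"
  shows "f = (\<Sum>v\<in>S. dconst (Poly_Mapping.lookup f (Poly_Mapping.single v 1)) * dvar_poly v)
              + U_free_part f"
proof (rule poly_mapping_eqI)
  fix m :: "dvar \<Rightarrow>\<^sub>0 nat"
  let ?free = "\<forall>j k. Uv j k \<notin> Poly_Mapping.keys m"
  have free: "Poly_Mapping.lookup (U_free_part f) m = (if ?free then Poly_Mapping.lookup f m else 0)"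
    by (simp add: U_free_part_def lookup_sum lookup_single when_def in_keys_iff)
  have lin_part: "Poly_Mapping.lookup
      (\<Sum>v\<in>S. dconst (Poly_Mapping.lookup f (Poly_Mapping.single v 1)) * dvar_poly v) m
      = (\<Sum>v\<in>S. if Poly_Mapping.single v 1 = m then Poly_Mapping.lookup f m else 0)" (is "_ = ?sum")
    by (auto simp: lookup_sum lookup_dconst_mult dvar_poly_def lookup_single when_def intro!: sum.cong)
  have sum_eq: "?sum = (if ?free then 0 else Poly_Mapping.lookup f m)"
  proof (cases ?free)
    case True
    have "Poly_Mapping.single v 1 \<noteq> m" if v: "v \<in> S" for v
    proof -
      obtain j k where "v = Uv j k" using v S(1) by auto
      then have "v \<notin> Poly_Mapping.keys m" using True by simp
      moreover have "v \<in> Poly_Mapping.keys (Poly_Mapping.single v (1::nat))" by simp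
      ultimately show ?thesis by metis
    qed
    then have "?sum = 0" by (intro sum.neutral ballI) (simp only: if_False)
    then show ?thesis using True by argo
  next
    case nfree: False
    then obtain j k where jk: "Uv j k \<in> Poly_Mapping.keys m" by blast
    show ?thesis
    proof (cases "m \<in> Poly_Mapping.keys f")
      case True
      then have m: "m = Poly_Mapping.single (Uv j k) 1"
        using lin jk by (fastforce simp: linear_dpoly_iff)
      have "Uv j k \<in> S" using S(2) True jk by (auto simp: vars_def)
      moreover have "Poly_Mapping.single v 1 = m \<longleftrightarrow> v = Uv j k" for v
        unfolding m by (metis keys_single one_neq_zero singleton_inject)
      ultimately have "?sum = Poly_Mapping.lookup f m" using fin by (simp only: sum.delta if_True)
      then show ?thesis using nfree by argo
    next
      case False
      then have "Poly_Mapping.lookup f m = 0" by (simp add: in_keys_iff)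
      moreover from this have "?sum = 0" by (intro sum.neutral) auto
      ultimately show ?thesis by argo
    qed
  qed
  show "Poly_Mapping.lookup f m = Poly_Mapping.lookup
     ((\<Sum>v\<in>S. dconst (Poly_Mapping.lookup f (Poly_Mapping.single v 1)) * dvar_poly v) + U_free_part f) m"
    by (simp only: lookup_add lin_part free sum_eq) simp
qed

section \<open>Rows and columns of the resultant matrix\<close>

text \<open>The rows are addressed by pairs \<open>(i, k)\<close> standing for \<open>\<partial>\<^sup>k F\<^sub>i\<close> and not by the polynomials: the
  pairs are distinct by construction, and the same pair locates a row of the perturbed system, its
  part \<open>\<partial>\<^sup>k F\<^sub>i\<close> free of \<open>p\<close> and its perturbation \<open>\<partial>\<^sup>k \<phi>\<^sub>i\<close>.\<close>
definition row_index :: "nat \<Rightarrow> (nat \<Rightarrow> 'a::comm_ring_1 dpoly) \<Rightarrow> (nat \<times> nat) list" where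
  "row_index n F = [(i, k). i \<leftarrow> [1..<n+1],
     k \<leftarrow> rev [0..<nat (total_ord n F - ord_U n (F i) - gamma n F + 1)]]"

lemma PS_rows_row_index:
  "PS_rows d n F = map (\<lambda>(i, k). (dp_deriv d ^^ k) (F i)) (row_index n F)"
  by (simp add: PS_rows_def row_index_def map_concat comp_def)

lemma set_row_index: "set (row_index n F) =
    {(i, k). i \<in> {1..n} \<and> int k \<le> total_ord n F - ord_U n (F i) - gamma n F}"
  by (auto simp: row_index_def)

lemma distinct_concat_map:
  assumes "distinct xs" "\<And>x. x \<in> set xs \<Longrightarrow> distinct (f x)"
    and "\<And>x y. x \<in> set xs \<Longrightarrow> y \<in> set xs \<Longrightarrow> x \<noteq> y \<Longrightarrow> set (f x) \<inter> set (f y) = {}"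
  shows "distinct (concat (map f xs))"
  using assms by (induction xs) fastforce+

lemma distinct_row_index: "distinct (row_index n F)"
  unfolding row_index_def by (rule distinct_concat_map) (auto simp: distinct_map inj_on_def)

text \<open>One list for each order of derivation; the lists are disjoint, which gives distinctness.\<close>
lemma PS_U_list_alt: "PS_U_list n F = concat (map (\<lambda>k. map (\<lambda>j. Uv j k)
    (filter (\<lambda>j. int k \<le> total_ord n F - gamma_at n F j - gamma n F) (rev [1..<n])))
    (rev [0..<nat (total_ord n F + 1)]))"
proof -
  have "concat (map (\<lambda>j. if Q j then [g j] else []) xs) = map g (filter Q xs)"
    for Q and g :: "nat \<Rightarrow> dvar" and xs by (induction xs) auto
  then show ?thesis by (simp add: PS_U_list_def)
qed

lemma distinct_PS_U_list: "distinct (PS_U_list n F)"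
  unfolding PS_U_list_alt by (rule distinct_concat_map) (auto simp: distinct_map inj_on_def)

lemma dord_le_ord_U: "j \<in> {1..n-1} \<Longrightarrow> dord f (Uv j) \<le> ord_U n f"
  unfolding ord_U_def by (rule Max_ge) auto

lemma gamma_at_nonneg:
  assumes "n \<ge> 1" "j \<in> {1..n-1}"
  shows "gamma_at n F j \<ge> 0"
  unfolding gamma_at_def using assms dord_le_ord_U[OF assms(2)] by (subst Min_ge_iff) auto

lemma gamma_nonneg: "n \<ge> 1 \<Longrightarrow> gamma n F \<ge> 0"
  unfolding gamma_def by (intro sum_nonneg gamma_at_nonneg) auto

lemma gamma_at_le: "i \<in> {1..n} \<Longrightarrow> gamma_at n F j \<le> ord_U n (F i) - dord (F i) (Uv j)"
  unfolding gamma_at_def by (rule Min_le) auto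

text \<open>The cut-off of the orders at \<open>total_ord n F\<close> in the list loses nothing, as the \<open>\<gamma>\<^sub>j\<close> and \<open>\<gamma>\<close> are
  nonnegative.\<close>
lemma set_PS_U_list:
  assumes "n \<ge> 1"
  shows "set (PS_U_list n F) = PS_U_vars n F"
proof -
  have "k < nat (total_ord n F + 1)"
    if "j \<in> {1..n-1}" "int k \<le> total_ord n F - gamma_at n F j - gamma n F" for j k
    using that gamma_at_nonneg[OF assms that(1), of F] gamma_nonneg[OF assms, of F] by linarith
  then show ?thesis using assms unfolding PS_U_list_alt PS_U_vars_def by fastforce
qed

lemma card_PS_U_vars:
  "card (PS_U_vars n F) = (\<Sum>j\<in>{1..n-1}. nat (total_ord n F - gamma_at n F j - gamma n F + 1))"
proof -
  let ?N = "\<lambda>j. nat (total_ord n F - gamma_at n F j - gamma n F + 1)"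
  have "PS_U_vars n F = case_prod Uv ` (SIGMA j:{1..n-1}. {..<?N j})"
    by (force simp: PS_U_vars_def)
  moreover have "inj_on (case_prod Uv) A" for A by (auto simp: inj_on_def)
  ultimately show ?thesis by (simp add: card_image)
qed

lemma length_row_index:
  "length (row_index n F) = (\<Sum>i\<in>{1..n}. nat (total_ord n F - ord_U n (F i) - gamma n F + 1))"
  by (simp add: row_index_def length_concat comp_def sum_list_distinct_conv_sum_set
      atLeastLessThanSuc_atLeastAtMost del: upt_Suc)

text \<open>With \<open>M = N - \<gamma> + 1\<close> there are \<open>(\<Sum>i. M - o\<^sub>i) = n * M - N\<close> rows and
  \<open>(\<Sum>j. M - \<gamma>\<^sub>j) = (n - 1) * M - \<gamma>\<close> columns of coefficients, and the difference is
  \<open>M - N + \<gamma> = 1\<close>.  The hypotheses keep the truncation at zero from interfering with either sum.\<close>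
lemma length_row_index_eq_Suc_columns:
  assumes n: "n \<ge> 1"
    and rows: "\<And>i. i \<in> {1..n} \<Longrightarrow> gamma n F \<le> total_ord n F - ord_U n (F i)"
    and cols: "\<And>j. j \<in> {1..n-1} \<Longrightarrow> gamma_at n F j \<le> total_ord n F - gamma n F"
  shows "length (row_index n F) = Suc (length (PS_U_list n F))"
proof -
  let ?M = "total_ord n F - gamma n F + 1"
  have "int (length (row_index n F)) = (\<Sum>i\<in>{1..n}. ?M - ord_U n (F i))"
    unfolding length_row_index of_nat_sum
  proof (rule sum.cong)
    fix i assume "i \<in> {1..n}"
    then show "int (nat (total_ord n F - ord_U n (F i) - gamma n F + 1)) = ?M - ord_U n (F i)"
      using rows[of i] by linarith
  qed simp
  also have "\<dots> = int n * ?M - total_ord n F"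
    by (simp add: sum_subtractf total_ord_def)
  finally have r: "int (length (row_index n F)) = int n * ?M - total_ord n F" .
  have "length (PS_U_list n F) = card (PS_U_vars n F)"
    by (metis distinct_PS_U_list distinct_card n set_PS_U_list)
  then have "int (length (PS_U_list n F)) = (\<Sum>j\<in>{1..n-1}. ?M - gamma_at n F j)"
    unfolding card_PS_U_vars
  proof (simp only: of_nat_sum, intro sum.cong)
    fix j assume "j \<in> {1..n-1}"
    then show "int (nat (total_ord n F - gamma_at n F j - gamma n F + 1)) = ?M - gamma_at n F j"
      using cols[of j] by linarith
  qed simp
  also have "\<dots> = int (n - 1) * ?M - gamma n F"
    by (simp add: sum_subtractf gamma_def)
  also have "\<dots> = int n * ?M - ?M - gamma n F"
    using n by (simp add: of_nat_diff algebra_simps)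
  finally show ?thesis using r by linarith
qed

section \<open>The determinant as a combination of the rows\<close>

text \<open>The cofactors of the last column form the last row of the adjugate.  They are therefore
  orthogonal to every other column, so the \<open>v c\<close> may be arbitrary: with the variables of the columns
  the bracket is the polynomial that the row lists, with zeros this is the expansion of the determinant
  along the last column.\<close>
lemma det_eliminate_columns:
  fixes M :: "'a::comm_ring_1 mat"
  assumes M: "M \<in> carrier_mat (Suc l) (Suc l)"
  shows "det M = (\<Sum>r<Suc l. cofactor M r l * ((\<Sum>c<l. M $$ (r, c) * v c) + M $$ (r, l)))"
proof -
  have adj: "(\<Sum>r<Suc l. cofactor M r l * M $$ (r, c)) = (if c = l then det M else 0)"
    if "c < Suc l" for c
  proof -
    have "(\<Sum>r<Suc l. cofactor M r l * M $$ (r, c)) = (adj_mat M * M) $$ (l, c)"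
      using M that
      by (simp del: sum.lessThan_Suc add: adj_mat_def scalar_prod_def atLeast0LessThan)
    also have "\<dots> = (if c = l then det M else 0)"
      using that by (simp add: adj_mat(3)[OF M])
    finally show ?thesis .
  qed
  have "(\<Sum>r<Suc l. cofactor M r l * ((\<Sum>c<l. M $$ (r, c) * v c) + M $$ (r, l)))
      = (\<Sum>c<l. (\<Sum>r<Suc l. cofactor M r l * M $$ (r, c)) * v c) + (\<Sum>r<Suc l. cofactor M r l * M $$ (r, l))"
    by (simp del: sum.lessThan_Suc add: ring_distribs sum.distrib sum_distrib_left sum_distrib_right mult.assoc)
       (rule sum.swap)
  also have "\<dots> = det M"
    using adj by (simp del: sum.lessThan_Suc)
  finally show ?thesis by (rule sym)
qed

text \<open>Deleting the last column makes its entries irrelevant, so the two matrices need to correspond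
  in the other columns only.  In this way the cofactors of the resultant matrix come from a matrix over
  \<open>K[p]\<close>, although the last column of the resultant matrix contains \<open>x\<^sub>i\<^sub>k\<close>.\<close>
lemma cofactor_map_mat_hom:
  fixes h :: "'a::comm_ring_1 \<Rightarrow> 'b::comm_ring_1"
  assumes "comm_ring_hom h" and A: "A \<in> carrier_mat (Suc l) (Suc l)"
    and B: "B \<in> carrier_mat (Suc l) (Suc l)"
    and eq: "\<And>r c. r < Suc l \<Longrightarrow> c < l \<Longrightarrow> B $$ (r, c) = h (A $$ (r, c))"
    and r: "r < Suc l"
  shows "cofactor B r l = h (cofactor A r l)"
proof -
  interpret comm_ring_hom h by fact
  have "mat_delete B r l = map_mat h (mat_delete A r l)"
    using A B r by (intro eq_matI) (auto simp: mat_delete_def intro!: eq)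
  then show ?thesis
    by (simp add: cofactor_def hom_det hom_mult hom_power hom_uminus)
qed

lemma comm_ring_hom_dconst_to_fract: "comm_ring_hom (\<lambda>q. dconst (to_fract q))"
  by unfold_locales (simp_all add: dconst_def single_add mult_single)

section \<open>The lowest power of the perturbation parameter\<close>

lemma Kp_deriv_Kp_embed:
  assumes d: "derivation d"
  shows "dp_deriv (Kp_deriv d) (Kp_embed f) = Kp_embed (dp_deriv d f)"
proof -
  have emb_add: "Kp_embed (g + h) = Kp_embed g + Kp_embed h" for g h :: "'a dpoly"
    by (rule poly_mapping_eqI) (simp add: lookup_Kp_embed lookup_add flip: to_fract_add)
  have emb_0: "Kp_embed 0 = (0 :: 'a poly fract dpoly)"
    by (rule poly_mapping_eqI) (simp add: lookup_Kp_embed)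
  have emb_sum: "Kp_embed (sum g S) = (\<Sum>s\<in>S. Kp_embed (g s))" for g :: "_ \<Rightarrow> 'a dpoly" and S
    by (induction S rule: infinite_finite_induct) (simp_all add: emb_0 emb_add)
  have emb_sum': "Kp_embed (sum g S) = (\<Sum>s\<in>S. Kp_embed (g s))" for g :: "dvar \<Rightarrow> 'a dpoly" and S
    by (induction S rule: infinite_finite_induct) (simp_all add: emb_0 emb_add)
  have emb_single: "Kp_embed (Poly_Mapping.single m c) = Poly_Mapping.single m (to_fract [:c:])"
    for m and c :: 'a
    by (rule poly_mapping_eqI) (simp add: lookup_Kp_embed lookup_single when_def)
  have keys: "Poly_Mapping.keys (Kp_embed f) = Poly_Mapping.keys f"
    by (auto simp: in_keys_iff lookup_Kp_embed)
  have of_nat: "to_fract [:of_nat k * c:] = of_nat k * to_fract [:c:]" for k and c :: 'a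
  proof -
    have "to_fract [:of_nat k:] = (of_nat k :: 'a poly fract)"
    proof (induction k)
      case (Suc k)
      have "[:of_nat (Suc k) :: 'a:] = 1 + [:of_nat k:]" by (simp add: one_pCons)
      then show ?case using Suc by (simp del: of_nat_Suc) simp
    qed simp
    moreover have "[:of_nat k * c:] = [:of_nat k:] * [:c:]" by simp
    ultimately show ?thesis by (simp only: to_fract_mult)
  qed
  have "Kp_deriv d (to_fract [:c:]) = to_fract [:d c:]" for c
  proof -
    have "map_poly d [:c:] = [:d c:]"
      by (rule poly_eqI) (simp add: coeff_map_poly coeff_pCons derivation_rules[OF d] split: nat.split)
    then show ?thesis by (simp add: Kp_deriv_to_fract[OF d])
  qed
  then show ?thesis
    unfolding dp_deriv_def keys emb_sum emb_sum' emb_add emb_single lookup_Kp_embed of_nat by simp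
qed

lemma Kp_deriv_Kp_indet:
  assumes d: "derivation d"
  shows "Kp_deriv d Kp_indet = 0"
proof -
  have "d 1 = 0"
    using derivation_rules(2)[OF d, of 1 1] by (metis add_cancel_left_right mult.right_neutral mult_1)
  then have "map_poly d [:0, 1:] = 0"
    by (intro poly_eqI) (simp add: coeff_map_poly coeff_pCons derivation_rules[OF d] split: nat.split)
  then show ?thesis by (simp add: Kp_indet_def Kp_deriv_to_fract[OF d])
qed

text \<open>The indeterminate \<open>p\<close> is a constant, so deriving the perturbed system perturbs the derivatives.\<close>
lemma deriv_iterate_perturbed:
  assumes d: "derivation d"
  shows "(dp_deriv (Kp_deriv d) ^^ k) (perturbed P \<phi> i)
    = Kp_embed ((dp_deriv d ^^ k) (dppe P i)) - dconst Kp_indet * Kp_embed ((dp_deriv d ^^ k) (\<phi> i))"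
proof (induction k)
  case (Suc k)
  note D = derivation_Kp_deriv[OF d]
  show ?case
    by (simp add: Suc derivation_rules[OF derivation_dp_deriv[OF D]] dp_deriv_dconst[OF D]
        Kp_deriv_Kp_indet[OF d] Kp_deriv_Kp_embed[OF d]) (simp add: dconst_def)
qed (simp add: perturbed_def)

text \<open>The least exponent \<open>a\<close> with a nonzero coefficient in some \<open>C r\<close> is the lowest degree of \<open>R\<close>: the
  products with \<open>p * g r\<close> start one degree later, and independence of the \<open>f r\<close> keeps the coefficient of
  \<open>p\<^sup>a\<close> from cancelling.\<close>
lemma p_coeff_lowest_combination:
  fixes C :: "nat \<Rightarrow> 'k::field poly" and f g :: "nat \<Rightarrow> 'k dpoly"
  assumes R: "R = (\<Sum>r<L. dconst (to_fract (C r)) * (Kp_embed (f r) - dconst Kp_indet * Kp_embed (g r)))"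
    and nz: "R \<noteq> 0"
    and indep: "\<And>c. (\<Sum>r<L. dconst (c r) * f r) = 0 \<Longrightarrow> \<forall>r<L. c r = 0"
  shows "\<exists>c. p_coeff R (p_low_degree R) = (\<Sum>r<L. dconst (c r) * f r)"
proof -
  have lookup_R: "Poly_Mapping.lookup R m = to_fract (\<Sum>r<L. C r *
      [:Poly_Mapping.lookup (f r) m, - Poly_Mapping.lookup (g r) m:])" for m
  proof -
    have ts: "(\<Sum>r\<in>S. to_fract (h r)) = to_fract (sum h S)" for h :: "nat \<Rightarrow> 'k poly" and S
      by (induction S rule: infinite_finite_induct) simp_all
    have "Poly_Mapping.lookup R m = (\<Sum>r<L. to_fract (C r *
        ([:Poly_Mapping.lookup (f r) m:] - [:0, 1:] * [:Poly_Mapping.lookup (g r) m:])))"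
      unfolding R by (simp only: lookup_sum lookup_dconst_mult lookup_minus lookup_Kp_embed
          Kp_indet_def to_fract_mult to_fract_diff)
    then show ?thesis by (simp add: ts)
  qed
  have coeff_C: "coeff (C r * [:a, - b:]) e
      = coeff (C r) e * a - (case e of 0 \<Rightarrow> 0 | Suc e' \<Rightarrow> coeff (C r) e' * b)" for r a b e
    by (simp add: coeff_pCons algebra_simps split: nat.split)
  \<comment> \<open>The factor \<open>p\<close> in front of \<open>g r\<close> shifts the coefficients of \<open>C r\<close> by one.\<close>
  have p_coeff_R: "p_coeff R e = (\<Sum>r<L. dconst (coeff (C r) e) * f r)
      - (\<Sum>r<L. dconst (case e of 0 \<Rightarrow> 0 | Suc e' \<Rightarrow> coeff (C r) e') * g r)" for e
  proof (rule poly_mapping_eqI)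
    fix m
    show "Poly_Mapping.lookup (p_coeff R e) m = Poly_Mapping.lookup
       ((\<Sum>r<L. dconst (coeff (C r) e) * f r)
      - (\<Sum>r<L. dconst (case e of 0 \<Rightarrow> 0 | Suc e' \<Rightarrow> coeff (C r) e') * g r)) m"
      unfolding lookup_p_coeff[OF lookup_R] coeff_sum coeff_C
      by (cases e) (simp_all add: lookup_minus lookup_sum lookup_dconst_mult sum_subtractf)
  qed
  have "\<exists>e. \<exists>r<L. coeff (C r) e \<noteq> 0"
  proof (rule ccontr)
    assume "\<nexists>e. \<exists>r<L. coeff (C r) e \<noteq> 0"
    then have "C r = 0" if "r < L" for r using that by (intro poly_eqI) auto
    then have "R = 0" unfolding R by (intro sum.neutral) (simp add: dconst_def)
    then show False using nz by contradiction
  qed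
  define a where "a = (LEAST e. \<exists>r<L. coeff (C r) e \<noteq> 0)"
  have a: "\<exists>r<L. coeff (C r) a \<noteq> 0"
    unfolding a_def by (rule LeastI_ex) fact
  have below: "coeff (C r) e = 0" if "e < a" "r < L" for e r
    using not_less_Least[of e "\<lambda>e. \<exists>r<L. coeff (C r) e \<noteq> 0"] that unfolding a_def by blast
  have dc0: "dconst 0 = (0::'k dpoly)" by (simp add: dconst_def)
  have g0: "(\<Sum>r<L. dconst (case e of 0 \<Rightarrow> 0 | Suc e' \<Rightarrow> coeff (C r) e') * g r) = 0" if "e \<le> a" for e
    using that below by (intro sum.neutral) (auto simp: dc0 split: nat.split)
  have p_coeff_a: "p_coeff R a = (\<Sum>r<L. dconst (coeff (C r) a) * f r)"
    using p_coeff_R[of a] g0[of a] by simp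
  have "p_low_degree R = a"
    unfolding p_low_degree_def
  proof (rule Least_equality)
    show "p_coeff R a \<noteq> 0"
      using indep[of "\<lambda>r. coeff (C r) a"] a unfolding p_coeff_a by blast
    show "a \<le> e" if "p_coeff R e \<noteq> 0" for e
    proof (rule ccontr)
      assume "\<not> a \<le> e"
      then have "p_coeff R e = 0"
        unfolding p_coeff_R using g0[of e] below by (simp add: dc0)
      with that show False by contradiction
    qed
  qed
  then show ?thesis using p_coeff_a by metis
qed

section \<open>Linear combinations in the generated ideal\<close>

text \<open>The coefficients are constants, so they lie in the ring whatever its variables \<open>W\<close> are.\<close>
lemma genideal_combination:
  fixes c :: "'b \<Rightarrow> 'a::comm_ring_1"
  assumes "finite S" and f: "\<And>s. s \<in> S \<Longrightarrow> f s \<in> G"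
  shows "(\<Sum>s\<in>S. dconst (c s) * f s) \<in> genideal (poly_ring W) G"
  unfolding genideal_def
proof clarify
  fix I assume I: "ideal I (poly_ring W)" and G: "G \<subseteq> I"
  interpret ideal I "poly_ring W" by fact
  have "dconst x \<in> polys_in W" for x :: 'a
    by (auto simp: polys_in_def vars_def dconst_def split: if_splits)
  then have term_mem: "dconst (c s) * f s \<in> I" if "s \<in> S" for s
    using I_l_closed[of "f s" "dconst (c s)"] f[OF that] G by (auto simp: poly_ring_def)
  show "(\<Sum>s\<in>S. dconst (c s) * f s) \<in> I"
    using \<open>finite S\<close> term_mem
  proof (induction S rule: finite_induct)
    case empty
    then show ?case using additive_subgroup.zero_closed[OF additive_subgroup_axioms] by (simp add: poly_ring_def)
  next
    case (insert s S)
    then show ?case using additive_subgroup.a_closed[OF additive_subgroup_axioms, of "dconst (c s) * f s"] by (simp add: poly_ring_def)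
  qed
qed


section \<open>The perturbed system and its lowest coefficient\<close>

lemma dnext_closed: "dnext ` X_vars n \<subseteq> X_vars n" "dnext ` U_vars n \<subseteq> U_vars n"
  by (auto simp: X_vars_def U_vars_def)

lemma dppe_deriv_iterate:
  assumes d: "derivation d"
  shows "(dp_deriv d ^^ k) (dppe P i) = dvar_poly (Xv i k) - (dp_deriv d ^^ k) (P i)"
  by (induction k)
     (simp_all add: dppe_def derivation_rules[OF derivation_dp_deriv[OF d]] dp_deriv_dvar_poly[OF d])

text \<open>Among the derivatives of the \<open>F\<^sub>i\<close>, the variable \<open>x\<^sub>i\<^sub>k\<close> occurs in \<open>\<partial>\<^sup>k F\<^sub>i\<close> only; this makes them
  linearly independent.\<close>
lemma lookup_dppe_deriv_iterate_Xv:
  assumes d: "derivation d" and P: "P i \<in> polys_in (U_vars n)"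
  shows "Poly_Mapping.lookup ((dp_deriv d ^^ k) (dppe P i)) (Poly_Mapping.single (Xv i' k') 1)
    = (if (i', k') = (i, k) then 1 else 0)"
proof -
  have "vars ((dp_deriv d ^^ k) (P i)) \<subseteq> U_vars n"
    using P by (intro vars_deriv_iterate_closed dnext_closed) (simp add: polys_in_def)
  then have "Xv i' k' \<notin> vars ((dp_deriv d ^^ k) (P i))"
    by (auto simp: U_vars_def)
  then have "Poly_Mapping.lookup ((dp_deriv d ^^ k) (P i)) (Poly_Mapping.single (Xv i' k') 1) = 0"
    by (rule lookup_single_not_vars)
  moreover have "Poly_Mapping.single (Xv i k) (1::nat) = Poly_Mapping.single (Xv i' k') 1
      \<longleftrightarrow> (i', k') = (i, k)"
    by (metis dvar.inject(1) keys_single one_neq_zero prod.inject singleton_inject)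
  ultimately show ?thesis
    by (simp add: dppe_deriv_iterate[OF d] lookup_minus dvar_poly_def lookup_single when_def)
qed

lemma keys_Kp_embed: "Poly_Mapping.keys (Kp_embed f) = Poly_Mapping.keys f"
  by (auto simp: in_keys_iff lookup_Kp_embed)

lemma linear_dpoly_Kp_embed: "linear_dpoly f \<Longrightarrow> linear_dpoly (Kp_embed f)"
  by (simp add: linear_dpoly_def keys_Kp_embed)

lemma linear_dpoly_dppe: "linear_dpoly (P i) \<Longrightarrow> linear_dpoly (dppe P i)"
  unfolding dppe_def by (intro linear_dpoly_diff linear_dpoly_dvar_poly)

lemma linear_dpoly_perturbed:
  "linear_dpoly (P i) \<Longrightarrow> linear_dpoly (\<phi> i) \<Longrightarrow> linear_dpoly (perturbed P \<phi> i)"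
  unfolding perturbed_def
  by (intro linear_dpoly_diff linear_dpoly_dconst_mult linear_dpoly_Kp_embed linear_dpoly_dppe)

lemma vars_perturbed:
  assumes "P i \<in> polys_in (U_vars n)" "\<phi> i \<in> polys_in (U_vars n)" "i \<in> {1..n}"
  shows "vars (perturbed P \<phi> i) \<subseteq> X_vars n \<union> U_vars n"
proof -
  have emb: "vars (Kp_embed h) = vars h" for h :: "'a dpoly"
    by (simp add: vars_def keys_Kp_embed)
  moreover have "vars (perturbed P \<phi> i) \<subseteq> vars (dppe P i) \<union> vars (\<phi> i)"
    unfolding perturbed_def
    using vars_diff[of "Kp_embed (dppe P i)" "dconst Kp_indet * Kp_embed (\<phi> i)"]
      vars_subset_keys[OF keys_dconst_mult[of Kp_indet "Kp_embed (\<phi> i)"]]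
    by (auto simp: emb)
  moreover have "vars (dppe P i) \<subseteq> {Xv i 0} \<union> vars (P i)"
    unfolding dppe_def using vars_diff[of "dvar_poly (Xv i 0)" "P i"] by (simp add: vars_dvar_poly)
  moreover have "Xv i 0 \<in> X_vars n" using assms(3) by (auto simp: X_vars_def)
  ultimately show ?thesis
    using assms(1,2) unfolding polys_in_def by blast
qed

text \<open>The order of \<open>\<partial>\<^sup>k F\<^sub>i\<close> in \<open>u\<^sub>j\<close> is at most
  \<open>ord(F\<^sub>i, u\<^sub>j) + (N - o\<^sub>i - \<gamma>)\<close>, and \<open>ord(F\<^sub>i, u\<^sub>j) - o\<^sub>i \<le> - \<gamma>\<^sub>j\<close> by the choice of \<open>\<gamma>\<^sub>j\<close> as a
  minimum.\<close>
lemma Uv_deriv_iterate_in_PS_U_vars: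
  assumes "vars (F i) \<subseteq> X_vars n \<union> U_vars n" "i \<in> {1..n}"
    and k: "int k \<le> total_ord n F - ord_U n (F i) - gamma n F"
    and jl: "Uv j l \<in> vars ((dp_deriv d ^^ k) (F i))"
  shows "Uv j l \<in> PS_U_vars n F"
proof -
  have "vars ((dp_deriv d ^^ k) (F i)) \<subseteq> X_vars n \<union> U_vars n"
    using assms(1) dnext_closed[of n] by (intro vars_deriv_iterate_closed) auto
  then have "j \<in> {1..n-1}" using jl by (auto simp: X_vars_def U_vars_def)
  moreover have "int l \<le> total_ord n F - gamma_at n F j - gamma n F"
    using Uv_deriv_iterate_dord[OF jl] gamma_at_le[OF assms(2), of F j] k by linarith
  ultimately show ?thesis by (simp add: PS_U_vars_def)
qed

lemma keys_p_coeff: "Poly_Mapping.keys (p_coeff R e) \<subseteq> Poly_Mapping.keys R"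
  by (auto simp: p_coeff_def in_keys_iff Poly_Mapping.map.rep_eq when_def)

theorem lemma6p5:
  fixes d :: "'k::field \<Rightarrow> 'k" and n :: nat and P \<phi> :: "nat \<Rightarrow> 'k dpoly"
  assumes "derivation d"
    and "n \<ge> 2"
    and "\<forall>i\<in>{1..n}. P i \<in> polys_in (U_vars n) \<and> linear_dpoly (P i)"
    and "\<exists>i\<in>{1..n}. P i \<notin> range dconst"
    and "\<forall>j\<in>{1..n-1}. \<exists>i\<in>{1..n}. dord (dppe P i) (Uv j) \<ge> 0"
    and "\<forall>i\<in>{1..n}. gamma n (dppe P) \<le> total_ord n (dppe P) - ord_U n (dppe P i)"
    and "\<forall>i\<in>{1..n}. \<phi> i \<in> polys_in (U_vars n) \<and> linear_dpoly (\<phi> i)"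
    and "\<forall>i\<in>{1..n}. ord_U n (perturbed P \<phi> i) = ord_U n (dppe P i)"
    and "\<forall>j\<in>{1..n-1}. gamma_at n (perturbed P \<phi>) j = gamma_at n (dppe P) j"
    and "dCRes (Kp_deriv d) n (perturbed P \<phi>) \<noteq> 0"
  shows "let R = dCRes (Kp_deriv d) n (perturbed P \<phi>);
             A = p_coeff R (p_low_degree R)
         in linear_dpoly A \<and>
            A \<in> genideal (poly_ring (PS_X_vars n (dppe P) \<union> PS_U_vars n (dppe P)))
                   (PS d n (dppe P)) \<inter> polys_in (X_vars n)"
proof -
  note d = assms(1) and P = assms(3) and \<phi> = assms(7)
  define F where "F = perturbed P \<phi>"
  define R where "R = dCRes (Kp_deriv d) n F"
  have ord_F: "ord_U n (F i) = ord_U n (dppe P i)" if "i \<in> {1..n}" for i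
    using bspec[OF assms(8) that] by (simp only: F_def)
  have gamma_at_F: "gamma_at n F j = gamma_at n (dppe P) j" if "j \<in> {1..n-1}" for j
    using bspec[OF assms(9) that] by (simp only: F_def)
  have total: "total_ord n F = total_ord n (dppe P)"
    unfolding total_ord_def by (rule sum.cong[OF refl]) (rule ord_F)
  have gamma: "gamma n F = gamma n (dppe P)"
    unfolding gamma_def by (rule sum.cong[OF refl]) (rule gamma_at_F)
  define idx where "idx = row_index n F"
  define cols where "cols = PS_U_list n F"
  define l where "l = length cols"
  have idx_mem: "i \<in> {1..n} \<and> int k \<le> total_ord n F - ord_U n (F i) - gamma n F"
    if "r < length idx" "idx ! r = (i, k)" for r i k
    using nth_mem[OF that(1)] that(2) set_row_index[of n F] by (auto simp: idx_def)
  have len: "length idx = Suc l"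
    unfolding idx_def cols_def l_def
  proof (rule length_row_index_eq_Suc_columns)
    show rows: "gamma n F \<le> total_ord n F - ord_U n (F i)" if "i \<in> {1..n}" for i
      using bspec[OF assms(6) that] ord_F[OF that] unfolding total gamma by simp
    show "gamma_at n F j \<le> total_ord n F - gamma n F" if j: "j \<in> {1..n-1}" for j
    proof -
      \<comment> \<open>Some \<open>F\<^sub>i\<close> has nonnegative order in \<open>u\<^sub>j\<close>, so \<open>\<gamma>\<^sub>j \<le> o\<^sub>i \<le> N - \<gamma>\<close>.\<close>
      obtain i where i: "i \<in> {1..n}" and "dord (dppe P i) (Uv j) \<ge> 0"
        using bspec[OF assms(5) j] by (elim bexE)
      then have "gamma_at n (dppe P) j \<le> ord_U n (dppe P i)"
        using gamma_at_le[OF i, of "dppe P" j] by linarith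
      then show ?thesis
        using rows[OF i] gamma_at_F[OF j] ord_F[OF i] by linarith
    qed
  qed (use assms(2) in simp)
  define f where "f r = (case idx ! r of (i, k) \<Rightarrow> (dp_deriv d ^^ k) (dppe P i))" for r
  define g where "g r = (case idx ! r of (i, k) \<Rightarrow> (dp_deriv d ^^ k) (\<phi> i))" for r
  define row where "row r = Kp_embed (f r) - dconst Kp_indet * Kp_embed (g r)" for r
  have row: "row r = (dp_deriv (Kp_deriv d) ^^ k) (F i)" if "idx ! r = (i, k)" for r i k
    using that by (simp add: row_def f_def g_def F_def deriv_iterate_perturbed[OF d])
  have vars_F: "vars (F i) \<subseteq> X_vars n \<union> U_vars n" if "i \<in> {1..n}" for i
    unfolding F_def using P \<phi> that by (intro vars_perturbed) auto
  have vars_row: "vars (row r) \<subseteq> X_vars n \<union> U_vars n" if "r < Suc l" for r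
  proof -
    obtain i k where ik: "idx ! r = (i, k)" by fastforce
    show ?thesis
      unfolding row[OF ik] using vars_F[of i] idx_mem[OF _ ik] that len dnext_closed[of n]
      by (intro vars_deriv_iterate_closed) auto
  qed
  define M where "M = mat (Suc l) (Suc l) (\<lambda>(r, c).
     if c < l then dconst (Poly_Mapping.lookup (row r) (Poly_Mapping.single (cols ! c) 1))
     else U_free_part (row r))"
  have M: "M \<in> carrier_mat (Suc l) (Suc l)" by (simp add: M_def)
  have det_M: "R = det M"
  proof -
    have "PS_rows (Kp_deriv d) n F ! r = row r" if "r < Suc l" for r
      using that len by (simp add: PS_rows_row_index idx_def[symmetric] row split: prod.split)
    moreover have "length (PS_rows (Kp_deriv d) n F) = Suc l"
      by (simp add: PS_rows_row_index idx_def[symmetric] len)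
    ultimately show ?thesis
      unfolding R_def dCRes_def Let_def M_def cols_def[symmetric]
      by (intro arg_cong[where f = det] eq_matI) auto
  qed
  have row_split: "row r = (\<Sum>c<l. M $$ (r, c) * dvar_poly (cols ! c)) + M $$ (r, l)"
    if r: "r < Suc l" for r
  proof -
    obtain i k where ik: "idx ! r = (i, k)" by fastforce
    then have i: "i \<in> {1..n}" and k: "int k \<le> total_ord n F - ord_U n (F i) - gamma n F"
      using idx_mem[OF _ ik] r len by auto
    have set_cols: "set cols = PS_U_vars n F"
      unfolding cols_def using assms(2) by (intro set_PS_U_list) auto
    have "linear_dpoly (row r)"
      unfolding row[OF ik] F_def using P \<phi> i
      by (intro linear_dpoly_deriv_iterate linear_dpoly_perturbed) auto
    then have "row r = (\<Sum>v\<in>set cols. dconst (Poly_Mapping.lookup (row r) (Poly_Mapping.single v 1)) * dvar_poly v)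
        + U_free_part (row r)"
    proof (rule linear_dpoly_eq_U_part)
      show "set cols \<subseteq> range (case_prod Uv)"
        unfolding set_cols PS_U_vars_def by auto
      show "Uv j m \<in> set cols" if "Uv j m \<in> vars (row r)" for j m
        unfolding set_cols
        using Uv_deriv_iterate_in_PS_U_vars[OF vars_F[OF i] i k] that unfolding row[OF ik] by blast
    qed simp
    also have "(\<Sum>v\<in>set cols. dconst (Poly_Mapping.lookup (row r) (Poly_Mapping.single v 1)) * dvar_poly v)
        = (\<Sum>c<l. dconst (Poly_Mapping.lookup (row r) (Poly_Mapping.single (cols ! c) 1)) * dvar_poly (cols ! c))"
      by (rule sum.reindex_bij_betw[OF bij_betw_nth, symmetric])
         (simp_all add: l_def distinct_PS_U_list cols_def)
    finally show ?thesis using r by (simp add: M_def)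
  qed
  \<comment> \<open>The coefficient columns of \<open>M\<close> over \<open>K[p]\<close>.  In the last column \<open>cols ! l\<close> is out of range, so
     the entries there are arbitrary; no cofactor of this column depends on them.\<close>
  define N where "N = mat (Suc l) (Suc l) (\<lambda>(r, c).
     [:Poly_Mapping.lookup (f r) (Poly_Mapping.single (cols ! c) 1),
       - Poly_Mapping.lookup (g r) (Poly_Mapping.single (cols ! c) 1):])"
  define C where "C r = cofactor N r l" for r
  have cof: "cofactor M r l = dconst (to_fract (C r))" if "r < Suc l" for r
    unfolding C_def
  proof (rule cofactor_map_mat_hom[OF comm_ring_hom_dconst_to_fract _ M _ that])
    fix r c assume "r < Suc l" "c < l"
    have "to_fract [:a, - b:] = to_fract [:a:] - Kp_indet * to_fract [:b:]" for a b :: 'k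
      by (simp add: Kp_indet_def flip: to_fract_mult to_fract_diff)
    then show "M $$ (r, c) = dconst (to_fract (N $$ (r, c)))"
      using \<open>r < Suc l\<close> \<open>c < l\<close>
      by (simp add: M_def N_def row_def lookup_minus lookup_dconst_mult lookup_Kp_embed)
  qed (simp add: N_def)
  have R_rows: "R = (\<Sum>r<Suc l. dconst (to_fract (C r)) * row r)"
    unfolding det_M det_eliminate_columns[OF M, of "\<lambda>c. dvar_poly (cols ! c)"]
    by (rule sum.cong) (simp_all add: cof flip: row_split)
  have indep: "\<forall>r<Suc l. c r = 0" if eq: "(\<Sum>r<Suc l. dconst (c r) * f r) = 0" for c
  proof (intro allI impI)
    fix s assume s: "s < Suc l"
    obtain i k where ik: "idx ! s = (i, k)" by fastforce
    have "Poly_Mapping.lookup (f r) (Poly_Mapping.single (Xv i k) 1) = (if r = s then 1 else 0)"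
      if r: "r < Suc l" for r
    proof -
      obtain i' k' where ik': "idx ! r = (i', k')" by fastforce
      have "P i' \<in> polys_in (U_vars n)" using idx_mem[OF _ ik'] r len P by auto
      moreover have "(i, k) = (i', k') \<longleftrightarrow> r = s"
        using nth_eq_iff_index_eq[of idx r s] distinct_row_index[of n F] r s len ik ik'
        by (auto simp: idx_def)
      ultimately show ?thesis
        unfolding f_def ik' prod.case by (simp only: lookup_dppe_deriv_iterate_Xv[OF d])
    qed
    then have "Poly_Mapping.lookup (\<Sum>r<Suc l. dconst (c r) * f r) (Poly_Mapping.single (Xv i k) 1)
        = (\<Sum>r<Suc l. if r = s then c r else 0)"
      unfolding lookup_sum lookup_dconst_mult by (intro sum.cong) auto
    also have "\<dots> = c s" using s by (simp del: sum.lessThan_Suc)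
    finally show "c s = 0" using eq by simp
  qed
  have "R \<noteq> 0" using assms(10) by (simp add: R_def F_def)
  define A where "A = p_coeff R (p_low_degree R)"
  obtain c where A: "A = (\<Sum>r<Suc l. dconst (c r) * f r)"
    unfolding A_def
    using p_coeff_lowest_combination[OF R_rows[unfolded row_def] \<open>R \<noteq> 0\<close> indep] by blast
  have f_PS: "f r \<in> PS d n (dppe P) \<and> linear_dpoly (f r)" if r: "r < Suc l" for r
  proof -
    obtain i k where ik: "idx ! r = (i, k)" by fastforce
    then have i: "i \<in> {1..n}" and k: "int k \<le> total_ord n F - ord_U n (F i) - gamma n F"
      using idx_mem[OF _ ik] r len by auto
    have fr: "f r = (dp_deriv d ^^ k) (dppe P i)" by (simp add: f_def ik)
    have "int k \<le> total_ord n (dppe P) - ord_U n (dppe P i) - gamma n (dppe P)"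
      using k ord_F[OF i] unfolding total gamma by simp
    then have "f r \<in> PS d n (dppe P)" unfolding fr PS_def using i by blast
    moreover have "linear_dpoly (f r)"
      unfolding fr using P i by (intro linear_dpoly_deriv_iterate linear_dpoly_dppe) auto
    ultimately show ?thesis ..
  qed
  have "linear_dpoly A"
    unfolding A by (intro linear_dpoly_sum linear_dpoly_dconst_mult) (use f_PS in blast)
  moreover have "A \<in> genideal (poly_ring W) (PS d n (dppe P))" for W
    unfolding A by (rule genideal_combination) (use f_PS in auto)
  moreover have "A \<in> polys_in (X_vars n)"
  proof -
    \<comment> \<open>Here the last column itself is used instead of the rows.\<close>
    have "Poly_Mapping.keys m \<subseteq> X_vars n" if "m \<in> Poly_Mapping.keys R" for m
    proof -
      have "R = (\<Sum>r<Suc l. cofactor M r l * M $$ (r, l))"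
        unfolding det_M det_eliminate_columns[OF M, of "\<lambda>_. 0"] by simp
      also have "\<dots> = (\<Sum>r<Suc l. dconst (to_fract (C r)) * U_free_part (row r))"
        by (rule sum.cong) (simp_all add: cof, simp_all add: M_def)
      finally have R_free: "R = (\<Sum>r<Suc l. dconst (to_fract (C r)) * U_free_part (row r))" .
      obtain r where "r \<in> {..<Suc l}"
        and "m \<in> Poly_Mapping.keys (dconst (to_fract (C r)) * U_free_part (row r))"
        by (rule UN_E[OF subsetD[OF keys_sum \<open>m \<in> Poly_Mapping.keys R\<close>[unfolded R_free]]])
      then have r: "r < Suc l" and m: "m \<in> Poly_Mapping.keys (U_free_part (row r))"
        using subsetD[OF keys_dconst_mult] by auto
      then have "m \<in> Poly_Mapping.keys (row r)" and free: "\<forall>j k. Uv j k \<notin> Poly_Mapping.keys m"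
        by (auto simp: U_free_part_def in_keys_iff lookup_sum lookup_single when_def split: if_splits)
      then have "Poly_Mapping.keys m \<subseteq> X_vars n \<union> U_vars n"
        using vars_row[OF r] by (auto simp: vars_def)
      then show ?thesis using free by (auto simp: U_vars_def)
    qed
    then show ?thesis
      using keys_p_coeff[of R "p_low_degree R"] by (fastforce simp: A_def polys_in_def vars_def)
  qed
  ultimately show ?thesis
    unfolding Let_def F_def[symmetric] R_def[symmetric] A_def[symmetric] by blast
qed

end
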